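(* Let $\mathfrak{M}(g,f)$ be a $B$-manifold of dimension $m+2n$ and let $h=h(z^1,\dots,z^{m+2n})$ be an arbitrary (differentiable) function. Then $\mathfrak{M}(hg,f)$ is a $B$-manifold if and only if $h=\mathrm{const}$.
   Context: Setting. $\mathfrak{M}$ is a manifold of dimension $2n+m$ with adapted local coordinates $(z^i,z^{n+i},z^{2n+a})$, $i=1,\dots,n$, $a=1,\dots,m$ (the case $m=0$ is allowed), whose coordinate changes have the form $z^i=\varphi^i(\bar z^1,\dots,\bar z^n)$, $z^{n+i}=\sum_k \frac{\partial\varphi^i}{\partial\bar z^k}\bar z^{n+k}$, $z^{2n+a}=\Theta^a(\bar z^1,\dots,\bar z^n;\bar z^{2n+1},\dots,\bar z^{2n+m})$. The tensor field $f$ of type $(1,1)$ is given in adapted coordinates by the constant components $f^{n+i}_{k}=\delta^i_k$ ($i,k=1,\dots,n$), all other components being zero; so $f^2=0$. Greek indices run over $1,\dots,2n+m$, repeated indices are summed, and $\partial_\sigma=\partial/\partial z^\sigma$. $\mathfrak{M}(g,f)$ denotes $\mathfrak{M}$ with a (pseudo-)Riemannian metric tensor $g=(g_{\alpha\beta})$ and the structure $f$; $\mathfrak{M}(hg,f)$ denotes the same manifold and structure with $g$ replaced by $hg$. $\mathfrak{M}(g,f)$ is a manifold of $B$-type if $g(fx,y)=g(x,fy)$ for all vector fields $x,y$. The partial derivatives of $g$ are pure toward $f$ if in adapted coordinates $$f^\lambda_\sigma\,\partial_\lambda g_{\alpha\beta}=f^\lambda_\alpha\,\partial_\sigma g_{\lambda\beta}=f^\lambda_\beta\,\partial_\sigma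 g_{\alpha\lambda}\quad\text{for all }\alpha,\beta,\sigma.$$ A manifold of $B$-type for which the partial derivatives of the components of $g$ are pure is called a $B$-manifold.
   Formalization: The manifold is taken to be connected and n ≥ 1 (otherwise non-constant h can occur); for the full B-manifold property of M(hg,f), h is taken nowhere zero so that hg is a metric, while for arbitrary h the B-type and purity identities for hg are shown equivalent to h = const. *)

theory Defs
  imports "HOL-Analysis.Analysis"
begin

text \<open>
  Coordinate indices are the elements of a finite type \<open>'d\<close>. A labelling \<open>e\<close>, a bijection from
  \<open>{1..2*n+m}\<close> onto \<open>'d\<close>, gives the numbered coordinates: \<open>z^i\<close> is the component \<open>e i\<close>. In this
  way \<open>m = 0\<close> is possible. Greek indices range over all of \<open>'d\<close>.

  A chart is a pair of a coordinate neighbourhood and its coordinate map. A geometric object is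
  given by its components with respect to each chart of the atlas. Values of the components at
  points outside of the chart, or for pairs that are not charts of the atlas, are irrelevant.
\<close>

type_synonym ('a, 'd) chart = "'a set \<times> ('a \<Rightarrow> real^'d)"

abbreviation dom :: "('a, 'd::finite) chart \<Rightarrow> 'a set" where
  "dom c \<equiv> fst c"

abbreviation coord :: "('a, 'd::finite) chart \<Rightarrow> 'a \<Rightarrow> real^'d" where
  "coord c \<equiv> snd c"

definition in_coords :: "('a, 'd::finite) chart \<Rightarrow> ('a \<Rightarrow> 'b) \<Rightarrow> real^'d \<Rightarrow> 'b" where
  "in_coords c F = F \<circ> inv_into (dom c) (coord c)"

definition partial :: "'d::finite \<Rightarrow> (real^'d \<Rightarrow> 'b::real_normed_vector) \<Rightarrow> real^'d \<Rightarrow> 'b" where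
  "partial \<sigma> F x = frechet_derivative F (at x) (axis \<sigma> 1)"

definition pd :: "('a, 'd::finite) chart \<Rightarrow> 'd \<Rightarrow> ('a \<Rightarrow> real) \<Rightarrow> 'a \<Rightarrow> real" where
  "pd c \<sigma> F p = partial \<sigma> (in_coords c F) (coord c p)"

text \<open>The predicate \<open>C2_on\<close> is used for open \<open>D\<close> only.\<close>

definition C2_on :: "(real^'d::finite) set \<Rightarrow> (real^'d \<Rightarrow> 'b::real_normed_vector) \<Rightarrow> bool" where
  "C2_on D F \<longleftrightarrow>
     F differentiable_on D \<and>
     (\<forall>\<sigma>. partial \<sigma> F differentiable_on D) \<and>
     (\<forall>\<sigma> \<tau>. continuous_on D (partial \<tau> (partial \<sigma> F)))"

text \<open>On \<open>D\<close>, \<open>F\<close> is a function of the coordinates with label in \<open>I\<close>.\<close>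

definition function_of_coords ::
  "(nat \<Rightarrow> 'd::finite) \<Rightarrow> nat set \<Rightarrow> (real^'d) set \<Rightarrow> (real^'d \<Rightarrow> real) \<Rightarrow> bool" where
  "function_of_coords e I D F \<longleftrightarrow>
     (\<forall>x\<in>D. \<forall>y\<in>D. (\<forall>j\<in>I. x $ e j = y $ e j) \<longrightarrow> F x = F y)"

text \<open>
  \<open>T\<close> is a coordinate change, from the barred to the unbarred coordinates. Once its components
  \<open>e i\<close> with \<open>1 \<le> i \<le> n\<close> are functions \<open>\<phi>^i\<close> of the first \<open>n\<close> barred coordinates, the partial
  derivatives of \<open>\<phi>^i\<close> are the partial derivatives of these components.
\<close>

definition adapted_change ::
  "nat \<Rightarrow> nat \<Rightarrow> (nat \<Rightarrow> 'd::finite) \<Rightarrow> (real^'d) set \<Rightarrow> (real^'d \<Rightarrow> real^'d) \<Rightarrow> bool" where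
  "adapted_change n m e D T \<longleftrightarrow>
     (\<forall>i\<in>{1..n}. function_of_coords e {1..n} D (\<lambda>x. T x $ e i)) \<and>
     (\<forall>i\<in>{1..n}. \<forall>x\<in>D.
        T x $ e (n+i) = (\<Sum>k=1..n. partial (e k) (\<lambda>y. T y $ e i) x * x $ e (n+k))) \<and>
     (\<forall>a\<in>{1..m}. function_of_coords e ({1..n} \<union> {2*n+1..2*n+m}) D (\<lambda>x. T x $ e (2*n+a)))"

definition carrier_of :: "('a, 'd::finite) chart set \<Rightarrow> 'a set" where
  "carrier_of A = (\<Union>c\<in>A. dom c)"

text \<open>
  Coordinate changes of class \<open>C^2\<close> are what is needed for tensor fields with differentiable
  components to make sense; smooth atlases are a special case. The Hausdorff property and second
  countability are inherited from the type of points.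
\<close>

definition adapted_manifold ::
  "nat \<Rightarrow> nat \<Rightarrow> (nat \<Rightarrow> 'd::finite) \<Rightarrow>
   ('a::{t2_space, second_countable_topology}, 'd) chart set \<Rightarrow> bool" where
  "adapted_manifold n m e A \<longleftrightarrow>
     bij_betw e {1..2*n+m} UNIV \<and>
     (\<forall>c\<in>A. open (dom c) \<and> open (coord c ` dom c) \<and>
        homeomorphism (dom c) (coord c ` dom c) (coord c) (inv_into (dom c) (coord c))) \<and>
     (\<forall>b\<in>A. \<forall>c\<in>A.
        C2_on (coord b ` (dom b \<inter> dom c)) (in_coords b (coord c)) \<and>
        adapted_change n m e (coord b ` (dom b \<inter> dom c)) (in_coords b (coord c)))"

definition differentiable_function ::
  "('a, 'd::finite) chart set \<Rightarrow> ('a \<Rightarrow> real) \<Rightarrow> bool" where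
  "differentiable_function A h \<longleftrightarrow>
     (\<forall>c\<in>A. \<forall>p\<in>dom c. in_coords c h differentiable (at (coord c p)))"

text \<open>The Jacobian \<open>\<partial>z^\<kappa>/\<partial>\<bar>z^\<alpha>\<close>, for \<open>z\<close> the coordinates of \<open>c\<close> and \<open>\<bar>z\<close> those of \<open>b\<close>.\<close>

definition jac ::
  "('a, 'd::finite) chart \<Rightarrow> ('a, 'd) chart \<Rightarrow> 'a \<Rightarrow> 'd \<Rightarrow> 'd \<Rightarrow> real" where
  "jac c b p \<kappa> \<alpha> = pd b \<alpha> (\<lambda>q. coord c q $ \<kappa>) p"

definition vector_field ::
  "('a, 'd::finite) chart set \<Rightarrow> (('a, 'd) chart \<Rightarrow> 'a \<Rightarrow> real^'d) \<Rightarrow> bool" where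
  "vector_field A X \<longleftrightarrow>
     (\<forall>c\<in>A. \<forall>p\<in>dom c. in_coords c (X c) differentiable (at (coord c p))) \<and>
     (\<forall>b\<in>A. \<forall>c\<in>A. \<forall>p\<in>dom b \<inter> dom c. \<forall>\<kappa>.
        X c p $ \<kappa> = (\<Sum>\<alpha>\<in>UNIV. jac c b p \<kappa> \<alpha> * X b p $ \<alpha>))"

definition covariant_2_tensor ::
  "('a, 'd::finite) chart set \<Rightarrow> (('a, 'd) chart \<Rightarrow> 'a \<Rightarrow> real^'d^'d) \<Rightarrow> bool" where
  "covariant_2_tensor A g \<longleftrightarrow>
     (\<forall>c\<in>A. \<forall>p\<in>dom c. in_coords c (g c) differentiable (at (coord c p))) \<and>
     (\<forall>b\<in>A. \<forall>c\<in>A. \<forall>p\<in>dom b \<inter> dom c. \<forall>\<alpha> \<beta>.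
        g b p $ \<alpha> $ \<beta> =
          (\<Sum>\<kappa>\<in>UNIV. \<Sum>\<mu>\<in>UNIV. jac c b p \<kappa> \<alpha> * jac c b p \<mu> \<beta> * g c p $ \<kappa> $ \<mu>))"

definition metric_tensor ::
  "('a, 'd::finite) chart set \<Rightarrow> (('a, 'd) chart \<Rightarrow> 'a \<Rightarrow> real^'d^'d) \<Rightarrow> bool" where
  "metric_tensor A g \<longleftrightarrow>
     covariant_2_tensor A g \<and>
     (\<forall>c\<in>A. \<forall>p\<in>dom c. transpose (g c p) = g c p \<and> invertible (g c p))"

text \<open>The entry \<open>f $ \<kappa> $ \<sigma>\<close> is \<open>f^\<kappa>_\<sigma>\<close>; the components are the same in all adapted charts.\<close>

definition f_tensor :: "nat \<Rightarrow> (nat \<Rightarrow> 'd::finite) \<Rightarrow> real^'d^'d" where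
  "f_tensor n e = (\<chi> \<kappa> \<sigma>. if \<exists>k\<in>{1..n}. \<sigma> = e k \<and> \<kappa> = e (n+k) then 1 else 0)"

definition B_type ::
  "nat \<Rightarrow> (nat \<Rightarrow> 'd::finite) \<Rightarrow> ('a, 'd) chart set \<Rightarrow>
   (('a, 'd) chart \<Rightarrow> 'a \<Rightarrow> real^'d^'d) \<Rightarrow> bool" where
  "B_type n e A g \<longleftrightarrow>
     (\<forall>X Y. vector_field A X \<longrightarrow> vector_field A Y \<longrightarrow>
       (\<forall>c\<in>A. \<forall>p\<in>dom c.
          (\<Sum>\<alpha>\<in>UNIV. \<Sum>\<beta>\<in>UNIV. g c p $ \<alpha> $ \<beta> * (f_tensor n e *v X c p) $ \<alpha> * Y c p $ \<beta>) =
          (\<Sum>\<alpha>\<in>UNIV. \<Sum>\<beta>\<in>UNIV. g c p $ \<alpha> $ \<beta> * X c p $ \<alpha> * (f_tensor n e *v Y c p) $ \<beta>)))"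

definition pure_derivatives ::
  "nat \<Rightarrow> (nat \<Rightarrow> 'd::finite) \<Rightarrow> ('a, 'd) chart set \<Rightarrow>
   (('a, 'd) chart \<Rightarrow> 'a \<Rightarrow> real^'d^'d) \<Rightarrow> bool" where
  "pure_derivatives n e A g \<longleftrightarrow>
     (\<forall>c\<in>A. \<forall>p\<in>dom c. \<forall>\<alpha> \<beta> \<sigma>.
        (\<Sum>\<kappa>\<in>UNIV. f_tensor n e $ \<kappa> $ \<sigma> * pd c \<kappa> (\<lambda>q. g c q $ \<alpha> $ \<beta>) p) =
        (\<Sum>\<kappa>\<in>UNIV. f_tensor n e $ \<kappa> $ \<alpha> * pd c \<sigma> (\<lambda>q. g c q $ \<kappa> $ \<beta>) p) \<and>
        (\<Sum>\<kappa>\<in>UNIV. f_tensor n e $ \<kappa> $ \<alpha> * pd c \<sigma> (\<lambda>q. g c q $ \<kappa> $ \<beta>) p) =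
        (\<Sum>\<kappa>\<in>UNIV. f_tensor n e $ \<kappa> $ \<beta> * pd c \<sigma> (\<lambda>q. g c q $ \<alpha> $ \<kappa>) p))"

definition B_manifold ::
  "nat \<Rightarrow> (nat \<Rightarrow> 'd::finite) \<Rightarrow> ('a, 'd) chart set \<Rightarrow>
   (('a, 'd) chart \<Rightarrow> 'a \<Rightarrow> real^'d^'d) \<Rightarrow> bool" where
  "B_manifold n e A g \<longleftrightarrow> metric_tensor A g \<and> B_type n e A g \<and> pure_derivatives n e A g"

definition conformal ::
  "('a \<Rightarrow> real) \<Rightarrow> (('a, 'd::finite) chart \<Rightarrow> 'a \<Rightarrow> real^'d^'d) \<Rightarrow>
   ('a, 'd) chart \<Rightarrow> 'a \<Rightarrow> real^'d^'d" where
  "conformal h g = (\<lambda>c p. h p *\<^sub>R g c p)"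

end

theory Submission
  imports Defs
begin

text \<open>
  By the product rule, purity of the derivatives of \<open>h g\<close>, given that of \<open>g\<close>, says that
  \<open>(f\<^sup>\<lambda>\<^sub>\<sigma> \<partial>\<^sub>\<lambda> h) g = (\<partial>\<^sub>\<sigma> h) f\<^sup>T g\<close> as matrices. Cancelling the invertible \<open>g\<close> leaves a multiple of the
  identity equal to a multiple of the nonzero matrix \<open>f\<^sup>T\<close>, whose diagonal vanishes; so
  \<open>\<partial>\<^sub>\<sigma> h = 0\<close>, and \<open>h\<close> is locally constant on a connected manifold.
\<close>

section \<open>Charts and the calculus of partial derivatives in them\<close>

lemma adapted_manifold_chartD:
  assumes "adapted_manifold n m e A" "c \<in> A"
  shows "open (dom c)" "open (coord c ` dom c)" "continuous_on (dom c) (coord c)"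
    "inj_on (coord c) (dom c)"
proof -
  have hom: "homeomorphism (dom c) (coord c ` dom c) (coord c) (inv_into (dom c) (coord c))"
    and "open (dom c)" "open (coord c ` dom c)"
    using assms unfolding adapted_manifold_def by auto
  then show "open (dom c)" "open (coord c ` dom c)" "continuous_on (dom c) (coord c)"
    by (auto simp: homeomorphism_def)
  show "inj_on (coord c) (dom c)"
    using hom by (intro inj_on_inverseI[of _ "inv_into (dom c) (coord c)"]) (auto simp: homeomorphism_def)
qed

text \<open>Off the image of the chart \<open>in_coords\<close> takes arbitrary values, through
  \<open>inv_into\<close>. A derivative at a point of this open image sees only values inside
  it.\<close>

lemma pd_cong:
  assumes "open (coord c ` dom c)" "p \<in> dom c"
    and eq: "\<And>q. q \<in> dom c \<Longrightarrow> F q = G q"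
  shows "pd c \<sigma> F p = pd c \<sigma> G p"
proof -
  \<comment> \<open>\<open>frechet_derivative\<close> chooses some \<open>D\<close> with this
    property, so equivalence for every \<open>D\<close> makes both choices coincide, even where no
    derivative exists.\<close>
  have "(in_coords c F has_derivative D) (at (coord c p)) \<longleftrightarrow>
        (in_coords c G has_derivative D) (at (coord c p))" for D
  proof
    assume "(in_coords c F has_derivative D) (at (coord c p))"
    then show "(in_coords c G has_derivative D) (at (coord c p))"
      by (rule has_derivative_transform_within_open[OF _ assms(1)])
        (use assms in \<open>auto simp: in_coords_def inv_into_into intro!: eq\<close>)
  next
    assume "(in_coords c G has_derivative D) (at (coord c p))"
    then show "(in_coords c F has_derivative D) (at (coord c p))"
      by (rule has_derivative_transform_within_open[OF _ assms(1)])
        (use assms in \<open>auto simp: in_coords_def inv_into_into intro!: eq[symmetric]\<close>)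
  qed
  then show ?thesis
    by (simp add: pd_def partial_def frechet_derivative_def)
qed

lemma pd_mult:
  assumes "inj_on (coord c) (dom c)" "p \<in> dom c"
    and "in_coords c F differentiable (at (coord c p))"
    and "in_coords c G differentiable (at (coord c p))"
  shows "pd c \<sigma> (\<lambda>q. F q * G q) p = pd c \<sigma> F p * G p + F p * pd c \<sigma> G p"
proof -
  let ?x = "coord c p"
  have eq: "in_coords c (\<lambda>q. F q * G q) = (\<lambda>x. in_coords c F x * in_coords c G x)"
    by (auto simp: in_coords_def)
  have val: "in_coords c F ?x = F p" "in_coords c G ?x = G p"
    using assms(1,2) by (auto simp: in_coords_def)
  have "((\<lambda>x. in_coords c F x * in_coords c G x) has_derivative
      (\<lambda>v. in_coords c F ?x * frechet_derivative (in_coords c G) (at ?x) v +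
           frechet_derivative (in_coords c F) (at ?x) v * in_coords c G ?x)) (at ?x)"
    using assms(3,4) by (intro has_derivative_mult) (simp_all add: frechet_derivative_works[symmetric])
  from frechet_derivative_at[OF this, symmetric] show ?thesis
    by (simp add: pd_def partial_def eq val)
qed

lemma pd_const_mult:
  assumes "inj_on (coord c) (dom c)" "p \<in> dom c"
    and "in_coords c G differentiable (at (coord c p))"
  shows "pd c \<sigma> (\<lambda>q. k * G q) p = k * pd c \<sigma> G p"
proof -
  have const: "in_coords c (\<lambda>q. k) = (\<lambda>x. k)"
    by (auto simp: in_coords_def)
  show ?thesis
    using pd_mult[OF assms(1,2) _ assms(3), of "\<lambda>q. k"]
    by (simp add: const pd_def[of _ _ "\<lambda>q. k"] partial_def frechet_derivative_const)
qed

lemma differentiable_component: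
  fixes F :: "'a::real_normed_vector \<Rightarrow> real^'i^'j"
  assumes "F differentiable (at x)"
  shows "(\<lambda>y. F y $ i $ j) differentiable (at x)"
proof -
  have "bounded_linear (\<lambda>M :: real^'i^'j. M $ i $ j)"
    by (rule bounded_linear_compose[OF bounded_linear_vec_nth bounded_linear_vec_nth])
  from bounded_linear.has_derivative[OF this] show ?thesis
    using assms unfolding differentiable_def by blast
qed

lemma covariant_2_tensor_component_differentiable:
  assumes "covariant_2_tensor A g" "c \<in> A" "p \<in> dom c"
  shows "in_coords c (\<lambda>q. g c q $ \<alpha> $ \<beta>) differentiable (at (coord c p))"
  using differentiable_component[of "in_coords c (g c)" "coord c p" \<alpha> \<beta>] assms
  unfolding covariant_2_tensor_def by (auto simp: in_coords_def o_def)

section \<open>Vanishing partial derivatives and constancy\<close>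

lemma linear_zero_on_axes:
  fixes L :: "real^'d::finite \<Rightarrow> 'b::real_vector"
  assumes "linear L" "\<And>\<sigma>. L (axis \<sigma> 1) = 0"
  shows "L = (\<lambda>v. 0)"
proof
  fix v
  have "L v = L (\<Sum>\<sigma>\<in>UNIV. v $ \<sigma> *\<^sub>R axis \<sigma> 1)"
    by (simp add: basis_expansion flip: scalar_mult_eq_scaleR)
  also have "\<dots> = 0"
    using assms by (simp add: linear_sum linear_scale)
  finally show "L v = 0" .
qed

text \<open>A zero derivative gives constancy on convex sets, so each point is surrounded by a
  coordinate ball inside the image of a chart. The preimage of the ball is an open neighbourhood on
  which \<open>h\<close> is constant, and connectedness passes from local to global.\<close>

lemma constant_on_if_pd_zero:
  assumes man: "adapted_manifold n m e A"
    and conn: "connected (carrier_of A)"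
    and diff: "differentiable_function A h"
    and zero: "\<And>c p \<sigma>. c \<in> A \<Longrightarrow> p \<in> dom c \<Longrightarrow> pd c \<sigma> h p = 0"
  shows "h constant_on carrier_of A"
proof (rule locally_constant_imp_constant[OF conn])
  fix p assume "p \<in> carrier_of A"
  then obtain c where c: "c \<in> A" "p \<in> dom c"
    by (auto simp: carrier_of_def)
  note chart = adapted_manifold_chartD[OF man c(1)]
  obtain r where r: "r > 0" "ball (coord c p) r \<subseteq> coord c ` dom c"
    using openE[OF chart(2)] c by blast
  let ?B = "ball (coord c p) r" and ?T = "dom c \<inter> coord c -` ball (coord c p) r"
  have deriv: "(in_coords c h has_derivative (\<lambda>v. 0)) (at x within ?B)" if x: "x \<in> ?B" for x
  proof -
    obtain q where q: "q \<in> dom c" "x = coord c q"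
      using r x by auto
    have D: "(in_coords c h has_derivative frechet_derivative (in_coords c h) (at x)) (at x)"
      using diff c q by (auto simp: differentiable_function_def frechet_derivative_works[symmetric])
    \<comment> \<open>Differentiability of \<open>h\<close> makes this a linear map; its values on
      the axes are the partial derivatives, all zero.\<close>
    have "frechet_derivative (in_coords c h) (at x) = (\<lambda>v. 0)"
      using zero[OF c(1) q(1)] has_derivative_linear[OF D]
      by (intro linear_zero_on_axes) (auto simp: pd_def partial_def q)
    with D show ?thesis
      by (simp add: has_derivative_at_withinI)
  qed
  obtain k where k: "\<And>x. x \<in> ?B \<Longrightarrow> in_coords c h x = k"
    using has_derivative_zero_constant[OF convex_ball deriv] by blast
  have "h q = k" if "q \<in> ?T" for q
    using k[of "coord c q"] that chart(4) by (simp add: in_coords_def)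
  moreover have "p \<in> ?T"
    using c r by simp
  moreover have "open ?T"
    using continuous_open_preimage[OF chart(3,1) open_ball] .
  moreover have "?T \<subseteq> carrier_of A"
    using c by (auto simp: carrier_of_def)
  ultimately show "\<exists>T. openin (top_of_set (carrier_of A)) T \<and> p \<in> T \<and> (\<forall>q\<in>T. h q = h p)"
    by (intro exI[of _ ?T]) (auto intro: open_subset)
qed

section \<open>Purity of the derivatives of \<open>h g\<close> annihilates those of
  \<open>h\<close>\<close>

lemma transpose_f_tensor_not_scalar:
  assumes inj: "inj_on e {1..2*n+m}" and n: "1 \<le> n"
    and eq: "a *\<^sub>R mat 1 = b *\<^sub>R transpose (f_tensor n e)"
  shows "b = 0"
proof -
  have ne: "e 1 \<noteq> e (n+k)" if "k \<in> {1..n}" for k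
    using that n inj_onD[OF inj, of 1 "n+k"] by auto
  have entry: "a * (if i = j then 1 else 0) = b * f_tensor n e $ j $ i" for i j
    using arg_cong[OF eq, of "\<lambda>M. M $ i $ j"] by (simp add: mat_def transpose_def)
  \<comment> \<open>This off-diagonal entry exists because \<open>1 \<le> n\<close>. The identity
    matrix has 0 in its place, so comparing the two entries gives \<open>b = 0\<close>.\<close>
  have "f_tensor n e $ e (n+1) $ e 1 = 1"
    using n by (auto simp: f_tensor_def intro!: bexI[of _ 1])
  with entry[of "e 1" "e (n+1)"] ne[of 1] n show "b = 0"
    by simp
qed

lemma pd_zero_if_conformal_pure:
  assumes n: "1 \<le> n"
    and man: "adapted_manifold n m e A"
    and met: "metric_tensor A g"
    and pure: "pure_derivatives n e A g"
    and diff: "differentiable_function A h"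
    and pure_h: "pure_derivatives n e A (conformal h g)"
    and c: "c \<in> A" "p \<in> dom c"
  shows "pd c \<sigma> h p = 0"
proof -
  let ?f = "f_tensor n e"
  define a where "a = (\<Sum>\<kappa>\<in>UNIV. ?f $ \<kappa> $ \<sigma> * pd c \<kappa> h p)"
  define u where "u = pd c \<sigma> h p"
  note chart = adapted_manifold_chartD[OF man c(1)]
  have dg: "in_coords c (\<lambda>q. g c q $ \<alpha> $ \<beta>) differentiable (at (coord c p))" for \<alpha> \<beta>
    using met c by (auto simp: metric_tensor_def intro: covariant_2_tensor_component_differentiable)
  have dh: "in_coords c h differentiable (at (coord c p))"
    using diff c by (auto simp: differentiable_function_def)
  have prod: "pd c \<kappa> (\<lambda>q. conformal h g c q $ \<alpha> $ \<beta>) p =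
      pd c \<kappa> h p * g c p $ \<alpha> $ \<beta> + h p * pd c \<kappa> (\<lambda>q. g c q $ \<alpha> $ \<beta>) p" for \<kappa> \<alpha> \<beta>
    using pd_mult[OF chart(4) c(2) dh dg] by (simp add: conformal_def)
  have entry: "a * g c p $ \<alpha> $ \<beta> = u * (\<Sum>\<kappa>\<in>UNIV. ?f $ \<kappa> $ \<alpha> * g c p $ \<kappa> $ \<beta>)" for \<alpha> \<beta>
  proof -
    \<comment> \<open>The purity equation relating \<sigma> and \<alpha> is taken for
      \<open>g\<close> and then for \<open>h g\<close>. After the product rule, the terms with
      derivatives of \<open>g\<close> are \<open>h p\<close> times the equation for \<open>g\<close>
      and cancel.\<close>
    have g_eq: "(\<Sum>\<kappa>\<in>UNIV. ?f $ \<kappa> $ \<sigma> * pd c \<kappa> (\<lambda>q. g c q $ \<alpha> $ \<beta>) p) =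
        (\<Sum>\<kappa>\<in>UNIV. ?f $ \<kappa> $ \<alpha> * pd c \<sigma> (\<lambda>q. g c q $ \<kappa> $ \<beta>) p)"
      using pure c unfolding pure_derivatives_def by blast
    have "(\<Sum>\<kappa>\<in>UNIV. ?f $ \<kappa> $ \<sigma> * pd c \<kappa> (\<lambda>q. conformal h g c q $ \<alpha> $ \<beta>) p) =
        (\<Sum>\<kappa>\<in>UNIV. ?f $ \<kappa> $ \<alpha> * pd c \<sigma> (\<lambda>q. conformal h g c q $ \<kappa> $ \<beta>) p)"
      using pure_h c unfolding pure_derivatives_def by blast
    then have "a * g c p $ \<alpha> $ \<beta> + h p * (\<Sum>\<kappa>\<in>UNIV. ?f $ \<kappa> $ \<sigma> * pd c \<kappa> (\<lambda>q. g c q $ \<alpha> $ \<beta>) p) =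
        u * (\<Sum>\<kappa>\<in>UNIV. ?f $ \<kappa> $ \<alpha> * g c p $ \<kappa> $ \<beta>) +
        h p * (\<Sum>\<kappa>\<in>UNIV. ?f $ \<kappa> $ \<alpha> * pd c \<sigma> (\<lambda>q. g c q $ \<kappa> $ \<beta>) p)"
      unfolding prod a_def u_def
      by (simp add: algebra_simps sum.distrib sum_distrib_left sum_distrib_right)
    with g_eq show ?thesis
      by simp
  qed
  \<comment> \<open>For fixed \<sigma> the scalars \<open>a\<close> and \<open>u\<close> do not
    depend on \<alpha> and \<beta>, so the entries form one matrix equation. The transpose appears
    because the sum runs over the upper, that is row, index of \<open>f\<close>.\<close>
  have mat: "a *\<^sub>R g c p = u *\<^sub>R (transpose ?f ** g c p)"
    using entry by (simp add: vec_eq_iff matrix_matrix_mult_def transpose_def)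
  obtain G where G: "g c p ** G = mat 1"
    using met c unfolding metric_tensor_def invertible_def by blast
  have "a *\<^sub>R mat 1 = (a *\<^sub>R g c p) ** G"
    by (simp add: G flip: scalar_matrix_assoc)
  also have "\<dots> = u *\<^sub>R transpose ?f"
    by (simp add: mat G flip: scalar_matrix_assoc matrix_mul_assoc)
  finally have "u = 0"
    using transpose_f_tensor_not_scalar man n unfolding adapted_manifold_def bij_betw_def by blast
  then show ?thesis
    by (simp add: u_def)
qed

section \<open>Transfer of the defining conditions from \<open>g\<close> to
  \<open>h g\<close>\<close>

lemma B_type_conformal:
  assumes "B_type n e A g"
  shows "B_type n e A (conformal h g)"
  unfolding B_type_def
proof (intro allI impI ballI)
  fix X Y c p
  assume "vector_field A X" "vector_field A Y" "c \<in> A" "p \<in> dom c"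
  then have "(\<Sum>\<alpha>\<in>UNIV. \<Sum>\<beta>\<in>UNIV. g c p $ \<alpha> $ \<beta> * (f_tensor n e *v X c p) $ \<alpha> * Y c p $ \<beta>) =
      (\<Sum>\<alpha>\<in>UNIV. \<Sum>\<beta>\<in>UNIV. g c p $ \<alpha> $ \<beta> * X c p $ \<alpha> * (f_tensor n e *v Y c p) $ \<beta>)"
    using assms unfolding B_type_def by blast
  \<comment> \<open>The condition is pointwise and linear in the metric: the factor
    \<open>h p\<close> comes out of both sides, for any \<open>h\<close>.\<close>
  then show "(\<Sum>\<alpha>\<in>UNIV. \<Sum>\<beta>\<in>UNIV. conformal h g c p $ \<alpha> $ \<beta> * (f_tensor n e *v X c p) $ \<alpha> * Y c p $ \<beta>) =
      (\<Sum>\<alpha>\<in>UNIV. \<Sum>\<beta>\<in>UNIV. conformal h g c p $ \<alpha> $ \<beta> * X c p $ \<alpha> * (f_tensor n e *v Y c p) $ \<beta>)"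
    by (simp add: conformal_def mult.assoc flip: sum_distrib_left)
qed

text \<open>The purity equations are linear in the derivatives of the metric, and a constant factor
  passes through each derivative.\<close>

lemma pure_derivatives_conformal_constant:
  assumes man: "adapted_manifold n m e A"
    and tens: "covariant_2_tensor A g"
    and pure: "pure_derivatives n e A g"
    and const: "h constant_on carrier_of A"
  shows "pure_derivatives n e A (conformal h g)"
proof -
  obtain k where k: "\<And>p. p \<in> carrier_of A \<Longrightarrow> h p = k"
    using const by (auto simp: constant_on_def)
  have scale: "pd c \<kappa> (\<lambda>q. conformal h g c q $ \<alpha> $ \<beta>) p = k * pd c \<kappa> (\<lambda>q. g c q $ \<alpha> $ \<beta>) p"
    if c: "c \<in> A" "p \<in> dom c" for c p \<kappa> \<alpha> \<beta>
  proof -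
    note chart = adapted_manifold_chartD[OF man c(1)]
    \<comment> \<open>The value of \<open>h\<close> is known to be \<open>k\<close> on the carrier
      alone, hence the replacement inside the chart.\<close>
    have "pd c \<kappa> (\<lambda>q. conformal h g c q $ \<alpha> $ \<beta>) p = pd c \<kappa> (\<lambda>q. k * g c q $ \<alpha> $ \<beta>) p"
      using c k by (intro pd_cong[OF chart(2)]) (auto simp: conformal_def carrier_of_def)
    also have "\<dots> = k * pd c \<kappa> (\<lambda>q. g c q $ \<alpha> $ \<beta>) p"
      by (rule pd_const_mult[OF chart(4) c(2) covariant_2_tensor_component_differentiable[OF tens c]])
    finally show ?thesis .
  qed
  have pull: "(\<Sum>\<kappa>\<in>UNIV. x \<kappa> * (k * y \<kappa>)) = k * (\<Sum>\<kappa>\<in>UNIV. x \<kappa> * y \<kappa>)" for x y :: "'a \<Rightarrow> real"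
    by (simp add: sum_distrib_left mult.left_commute)
  show ?thesis
    using pure unfolding pure_derivatives_def by (simp add: scale pull)
qed

text \<open>As \<open>h\<close> is a scalar, the same factor \<open>h p\<close> stands on both sides
  of the transformation law. That \<open>h\<close> has no zeros keeps the matrices
  invertible.\<close>

lemma metric_tensor_conformal:
  assumes met: "metric_tensor A g"
    and diff: "differentiable_function A h"
    and nz: "\<And>p. p \<in> carrier_of A \<Longrightarrow> h p \<noteq> 0"
  shows "metric_tensor A (conformal h g)"
  unfolding metric_tensor_def covariant_2_tensor_def
proof (intro conjI ballI allI)
  fix c p assume c: "c \<in> A" "p \<in> dom c"
  have "in_coords c (conformal h g c) = (\<lambda>x. in_coords c h x *\<^sub>R in_coords c (g c) x)"
    by (auto simp: in_coords_def conformal_def)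
  then show "in_coords c (conformal h g c) differentiable (at (coord c p))"
    using met diff c
    by (auto simp: metric_tensor_def covariant_2_tensor_def differentiable_function_def
        intro!: differentiable_scaleR)
  show "transpose (conformal h g c p) = conformal h g c p"
    using met c by (simp add: metric_tensor_def conformal_def transpose_scalar)
  have "invertible (g c p)" "h p \<noteq> 0"
    using met nz c by (auto simp: metric_tensor_def carrier_of_def)
  then show "invertible (conformal h g c p)"
    by (simp add: conformal_def scalar_invertible_iff)
next
  fix b c p \<alpha> \<beta> assume "b \<in> A" "c \<in> A" "p \<in> dom b \<inter> dom c"
  then have "g b p $ \<alpha> $ \<beta> =
      (\<Sum>\<kappa>\<in>UNIV. \<Sum>\<mu>\<in>UNIV. jac c b p \<kappa> \<alpha> * jac c b p \<mu> \<beta> * g c p $ \<kappa> $ \<mu>)"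
    using met unfolding metric_tensor_def covariant_2_tensor_def by blast
  then show "conformal h g b p $ \<alpha> $ \<beta> =
      (\<Sum>\<kappa>\<in>UNIV. \<Sum>\<mu>\<in>UNIV. jac c b p \<kappa> \<alpha> * jac c b p \<mu> \<beta> * conformal h g c p $ \<kappa> $ \<mu>)"
    by (simp add: conformal_def sum_distrib_left mult.left_commute)
qed

theorem theorem5:
  fixes n m :: nat
    and e :: "nat \<Rightarrow> 'd::finite"
    and A :: "('a::{t2_space, second_countable_topology}, 'd) chart set"
    and g :: "('a, 'd) chart \<Rightarrow> 'a \<Rightarrow> real^'d^'d"
    and h :: "'a \<Rightarrow> real"
  assumes "1 \<le> n"
    and "adapted_manifold n m e A"
    and "connected (carrier_of A)"
    and "B_manifold n e A g"
    and "differentiable_function A h"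
  shows "(B_type n e A (conformal h g) \<and> pure_derivatives n e A (conformal h g)
            \<longleftrightarrow> h constant_on carrier_of A) \<and>
         ((\<forall>p\<in>carrier_of A. h p \<noteq> 0) \<longrightarrow>
            (B_manifold n e A (conformal h g) \<longleftrightarrow> h constant_on carrier_of A))"
proof -
  have g: "metric_tensor A g" "B_type n e A g" "pure_derivatives n e A g" "covariant_2_tensor A g"
    using assms(4) by (auto simp: B_manifold_def metric_tensor_def)
  \<comment> \<open>Where \<open>h\<close> vanishes, \<open>h g\<close> is degenerate and not a
    metric. The equivalence is therefore proved first for the two conditions on \<open>f\<close>; a
    nowhere vanishing \<open>h\<close> then supplies the metric property.\<close>
  have "B_type n e A (conformal h g) \<and> pure_derivatives n e A (conformal h g)
      \<longleftrightarrow> h constant_on carrier_of A"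
    using B_type_conformal[OF g(2)] pure_derivatives_conformal_constant[OF assms(2) g(4,3)]
      constant_on_if_pd_zero[OF assms(2,3,5)]
      pd_zero_if_conformal_pure[OF assms(1,2) g(1,3) assms(5)]
    by blast
  then show ?thesis
    using metric_tensor_conformal[OF g(1) assms(5)] unfolding B_manifold_def by blast
qed

end
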